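(* Every $2$-tree $\nabla$ with $|V(\nabla)|\geq 4$ has a crystallized vertex.
   Context: A $2$-tree is a graph $\nabla$ which is either a $2$-vertex complete graph, or has $h>2$ vertices and admits a bijection $\varpi:\{1,\ldots,h\}\to V(\nabla)$ such that for every $i\in\{1,\ldots,h-2\}$, the set of neighbors of $\varpi(i)$ in $V(\nabla)\setminus\{\varpi(1),\ldots,\varpi(i)\}$ is a clique of size $2$. In a graph $H$, a vertex $z$ is crystallized if there is a $2$-clique $\{z_1,z_2\}\subseteq N_H(z)$ such that: (C1) $N_H(z)\setminus\{z_1,z_2\}$ is a non-empty stable set in $H$; and (C2) there is a partition $(S_1,S_2)$ of $N_H(z)\setminus\{z_1,z_2\}$ such that for each $i\in\{1,2\}$ and every $x\in S_i$, $N_H(x)=\{z_i,z\}$. Here $N_H(v)$ is the set of neighbors of $v$ in $H$. *)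

theory Defs
  imports "HOL-Library.Ramsey"
begin

text \<open>
  Graphs are finite and simple, given by a vertex set \<open>V\<close> and a set \<open>E\<close> of two-element subsets
  of \<open>V\<close>. Cliques and stable sets are \<open>clique\<close> and \<open>indep\<close> from the Ramsey theory.
\<close>

definition fin_simple_graph :: "'a set \<Rightarrow> 'a set set \<Rightarrow> bool" where
  "fin_simple_graph V E \<longleftrightarrow> finite V \<and> E \<subseteq> nsets V 2"

definition neighbors :: "'a set set \<Rightarrow> 'a \<Rightarrow> 'a set" where
  "neighbors E v = {u. {v, u} \<in> E}"

definition two_tree :: "'a set \<Rightarrow> 'a set set \<Rightarrow> bool" where
  "two_tree V E \<longleftrightarrow> fin_simple_graph V E \<and>
    (card V = 2 \<and> clique V E \<or>
     card V > 2 \<and>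
     (\<exists>\<pi>. bij_betw \<pi> {1..card V} V \<and>
       (\<forall>i\<in>{1..card V - 2}.
          let K = neighbors E (\<pi> i) \<inter> (V - \<pi> ` {1..i})
          in card K = 2 \<and> clique K E)))"

text \<open>
  One of the two parts \<open>S1\<close>, \<open>S2\<close> may be empty, so \<open>partition_on\<close>, whose blocks are nonempty,
  does not apply. Allowing this is necessary: in the two-tree with four vertices the part to be
  split has at most one element.
\<close>

definition crystallized :: "'a set \<Rightarrow> 'a set set \<Rightarrow> 'a \<Rightarrow> bool" where
  "crystallized V E z \<longleftrightarrow> z \<in> V \<and>
    (\<exists>z1 z2. z1 \<noteq> z2 \<and> {z1, z2} \<subseteq> neighbors E z \<and> clique {z1, z2} E \<and>
      (let R = neighbors E z - {z1, z2}
       in R \<noteq> {} \<and> indep R E \<and>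
          (\<exists>S1 S2. S1 \<union> S2 = R \<and> S1 \<inter> S2 = {} \<and>
             (\<forall>x\<in>S1. neighbors E x = {z1, z}) \<and>
             (\<forall>x\<in>S2. neighbors E x = {z2, z}))))"

end

theory Submission
  imports Defs
begin

text \<open>
  Call a vertex of the elimination order good if it has no earlier neighbours, so that its
  neighbourhood is a clique of size \<open>2\<close> consisting of later vertices; no two good vertices are
  adjacent. If some vertex other than the last two is not good, then the first such vertex \<open>z\<close> is
  crystallized: \<open>{z1, z2}\<close> is the set of its later neighbours, and each of its earlier neighbours is
  good, with \<open>z\<close> and one of \<open>z1, z2\<close> as its only neighbours. Otherwise every vertex
  other than the last two is adjacent to exactly these two, and each of these two is crystallized.
\<close>

text \<open>The partition can be read off from the neighbourhoods: the part belonging to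
  \<open>w\<close> consists of those \<open>x\<close> with neighbourhood \<open>{w, z}\<close>, and
  \<open>z1 \<noteq> z2\<close> makes the two parts disjoint. Stability also follows from
  \<open>nb\<close>: a neighbour of such an \<open>x\<close> is \<open>z\<close>, \<open>z1\<close>
  or \<open>z2\<close>, none of which lies in \<open>R\<close>.\<close>

lemma crystallizedI:
  assumes E: "E \<subseteq> nsets V 2"
    and edges: "{z, z1} \<in> E" "{z, z2} \<in> E" "{z1, z2} \<in> E"
    and ne: "neighbors E z - {z1, z2} \<noteq> {}"
    and nb: "\<And>x. x \<in> neighbors E z - {z1, z2} \<Longrightarrow> neighbors E x = {z1, z} \<or> neighbors E x = {z2, z}"
  shows "crystallized V E z"
proof -
  define R where "R = neighbors E z - {z1, z2}"
  define S where "S = (\<lambda>w. {x \<in> R. neighbors E x = {w, z}})"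
  have irrefl: "u \<noteq> v" and inV: "u \<in> V" if "{u, v} \<in> E" for u v
    using that E by (auto simp: nsets_def card_insert_if split: if_splits)
  have "z1 \<noteq> z2"
    using irrefl edges(3) by blast
  moreover have "indep R E"
    unfolding indep_def
  proof (intro ballI impI notI)
    fix x y assume "x \<in> R" "y \<in> R" "{x, y} \<in> E"
    then show False
      using nb[of x] irrefl by (fastforce simp: R_def neighbors_def)
  qed
  moreover have "S z1 \<union> S z2 = R"
    using nb by (auto simp: S_def R_def)
  moreover have "S z1 \<inter> S z2 = {}"
    using \<open>z1 \<noteq> z2\<close> by (auto simp: S_def doubleton_eq_iff)
  moreover have "\<forall>x\<in>S z1. neighbors E x = {z1, z}" "\<forall>x\<in>S z2. neighbors E x = {z2, z}"
    by (auto simp: S_def)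
  moreover have "{z1, z2} \<subseteq> neighbors E z" "clique {z1, z2} E"
    using edges by (auto simp: neighbors_def clique_def insert_commute)
  ultimately have "z1 \<noteq> z2 \<and> {z1, z2} \<subseteq> neighbors E z \<and> clique {z1, z2} E \<and>
      R \<noteq> {} \<and> indep R E \<and> S z1 \<union> S z2 = R \<and> S z1 \<inter> S z2 = {} \<and>
      (\<forall>x\<in>S z1. neighbors E x = {z1, z}) \<and> (\<forall>x\<in>S z2. neighbors E x = {z2, z})"
    using ne by (simp add: R_def)
  then show ?thesis
    unfolding crystallized_def Let_def R_def
    using inV[OF edges(1)] by (intro conjI exI[of _ z1] exI[of _ z2] exI[of _ "S z1"] exI[of _ "S z2"]) simp_all
qed

theorem theorem3p4:
  fixes V :: "'a set" and E :: "'a set set"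
  assumes "two_tree V E" and "card V \<ge> 4"
  shows "\<exists>z. crystallized V E z"
proof -
  define h where "h = card V"
  define N where "N = neighbors E"
  have h: "h \<ge> 4"
    using assms(2) by (simp add: h_def)
  from assms have E: "E \<subseteq> nsets V 2"
    by (simp add: two_tree_def fin_simple_graph_def)
  from assms obtain \<pi> where bij: "bij_betw \<pi> {1..h} V"
    and elim: "\<forall>i\<in>{1..h - 2}. let K = N (\<pi> i) \<inter> (V - \<pi> ` {1..i}) in card K = 2 \<and> clique K E"
    unfolding two_tree_def h_def N_def by auto
  \<comment> \<open>\<open>K i\<close> collects the later neighbours of \<open>\<pi> i\<close>, so
    being good is the equation \<open>N (\<pi> i) = K i\<close>.\<close>
  define K where "K i = N (\<pi> i) \<inter> (V - \<pi> ` {1..i})" for i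
  have K: "card (K i) = 2" "clique (K i) E" if "i \<in> {1..h - 2}" for i
    using elim that by (auto simp: K_def Let_def)
  have inj: "inj_on \<pi> {1..h}" and img: "\<pi> ` {1..h} = V"
    using bij by (auto simp: bij_betw_def)
  have edge: "u \<noteq> v" "u \<in> V" "v \<in> V" if "{u, v} \<in> E" for u v
    using that E by (auto simp: nsets_def card_insert_if split: if_splits)
  have N_iff: "v \<in> N u \<longleftrightarrow> {u, v} \<in> E" for u v
    by (simp add: N_def neighbors_def)
  have N_sym: "u \<in> N v" if "v \<in> N u" for u v
    using that by (simp add: N_iff insert_commute)
  have K_later: "\<exists>j. i < j \<and> j \<le> h \<and> v = \<pi> j" if "v \<in> K i" "i \<ge> 1" for i v
  proof -
    from that img obtain j where "j \<in> {1..h}" "v = \<pi> j" "v \<notin> \<pi> ` {1..i}"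
      by (auto simp: K_def)
    then show ?thesis
      by (metis atLeastAtMost_iff image_eqI linorder_not_le)
  qed
  \<comment> \<open>If two good vertices were adjacent, each would be a later neighbour of the
    other.\<close>
  have good_stable: "\<pi> k \<notin> N (\<pi> j)"
    if "N (\<pi> j) = K j" "N (\<pi> k) = K k" "j \<in> {1..h}" "k \<in> {1..h}" for j k
  proof
    assume "\<pi> k \<in> N (\<pi> j)"
    then have "\<pi> k \<in> K j" "\<pi> j \<in> K k"
      using that N_sym by blast+
    then have "j < k" "k < j"
      using K_later[of "\<pi> k" j] K_later[of "\<pi> j" k] that inj by (auto dest: inj_onD)
    then show False by simp
  qed
  show ?thesis
  proof (cases "\<exists>i. i \<in> {1..h - 2} \<and> N (\<pi> i) \<noteq> K i")
    case True
    define i where "i = (LEAST i. i \<in> {1..h - 2} \<and> N (\<pi> i) \<noteq> K i)"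
    have i: "i \<in> {1..h - 2}" "N (\<pi> i) \<noteq> K i"
      using LeastI_ex[OF True] by (auto simp: i_def)
    have good: "N (\<pi> j) = K j" if "1 \<le> j" "j < i" for j
      using not_less_Least[OF that(2)[unfolded i_def]] that i(1) by fastforce
    obtain z1 z2 where z12: "K i = {z1, z2}" "z1 \<noteq> z2"
      using K(1)[OF i(1)] by (auto simp: card_2_iff)
    have earlier: "\<exists>j. 1 \<le> j \<and> j < i \<and> x = \<pi> j" if "x \<in> N (\<pi> i) - K i" for x
    proof -
      have "x \<in> \<pi> ` {1..i}" "x \<noteq> \<pi> i"
        using that edge[of "\<pi> i" x] by (auto simp: K_def N_iff)
      then show ?thesis
        by (auto simp: le_less)
    qed
    have "crystallized V E (\<pi> i)"
    proof (rule crystallizedI[OF E, folded N_def])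
      show "{\<pi> i, z1} \<in> E" "{\<pi> i, z2} \<in> E"
        using z12 by (auto simp: K_def N_iff[symmetric])
      show "{z1, z2} \<in> E"
        using K(2)[OF i(1)] z12 by (auto simp: clique_def)
      show "N (\<pi> i) - {z1, z2} \<noteq> {}"
        using i(2) z12 by (auto simp: K_def)
    next
      fix x assume "x \<in> N (\<pi> i) - {z1, z2}"
      with z12 have x: "x \<in> N (\<pi> i) - K i"
        by simp
      then obtain j where j: "1 \<le> j" "j < i" "x = \<pi> j"
        using earlier by blast
      have j_le: "j \<in> {1..h - 2}"
        using j i(1) by auto
      \<comment> \<open>Since \<open>x\<close> is good, its neighbour \<open>\<pi> i\<close> is one
        of the two elements of \<open>K j\<close>. It remains to show that the other one,
        \<open>w\<close>, is \<open>z1\<close> or \<open>z2\<close>; the clique \<open>K j\<close>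
        makes it adjacent to \<open>\<pi> i\<close>.\<close>
      have "\<pi> i \<in> K j"
        using x good[OF j(1,2)] j(3) N_sym by blast
      then obtain w where w: "K j = {w, \<pi> i}" "w \<noteq> \<pi> i"
        using K(1)[OF j_le] by (auto simp: card_2_iff doubleton_eq_iff)
      have "w \<in> N (\<pi> i)"
        using K(2)[OF j_le] w by (auto simp: clique_def N_iff)
      \<comment> \<open>An earlier neighbour of \<open>\<pi> i\<close> is good by the minimality of
        \<open>i\<close>, hence not adjacent to the good vertex \<open>x\<close>, whereas
        \<open>w\<close> is.\<close>
      moreover have "w \<notin> N (\<pi> i) - K i"
      proof
        assume "w \<in> N (\<pi> i) - K i"
        then obtain k where k: "1 \<le> k" "k < i" "w = \<pi> k"
          using earlier by blast
        have "\<pi> k \<notin> N (\<pi> j)"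
          using good_stable[OF good[OF j(1,2)] good[OF k(1,2)]] j k i(1) by auto
        then show False
          using good[OF j(1,2)] w k(3) by simp
      qed
      ultimately have "w = z1 \<or> w = z2"
        using z12 by auto
      then show "N x = {z1, \<pi> i} \<or> N x = {z2, \<pi> i}"
        using good[OF j(1,2)] w j(3) by auto
    qed
    then show ?thesis ..
  next
    case False
    define a b where "a = \<pi> (h - 1)" and "b = \<pi> h"
    have N_early: "N (\<pi> j) = {b, a}" if j: "j \<in> {1..h - 2}" for j
    proof -
      have good: "N (\<pi> k) = K k" if "k \<in> {1..h - 2}" for k
        using False that by auto
      have "K j \<subseteq> {b, a}"
      proof
        fix v assume v: "v \<in> K j"
        then obtain k where k: "j < k" "k \<le> h" "v = \<pi> k"
          using K_later j by fastforce
        \<comment> \<open>All of the first \<open>h - 2\<close> vertices are good here, so none of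
          them can be adjacent to \<open>\<pi> j\<close>.\<close>
        have "\<not> k \<le> h - 2"
          using good_stable[OF good[OF j] good[of k]] v k j good[OF j] by auto
        then have "k = h - 1 \<or> k = h"
          using k by auto
        then show "v \<in> {b, a}"
          using k by (auto simp: a_def b_def)
      qed
      \<comment> \<open>Comparing sizes turns the inclusion into an equality.\<close>
      moreover have "card {b, a} \<le> card (K j)"
        using K(1)[OF j] by (simp add: card_insert_if)
      ultimately show ?thesis
        using good[OF j] by (simp add: card_seteq)
    qed
    \<comment> \<open>This is where \<open>h \<ge> 4\<close> enters: one early vertex completes a
      triangle with \<open>a\<close> and \<open>b\<close>, and a second one keeps the set of
      remaining neighbours of \<open>a\<close> nonempty.\<close>
    have early: "1 \<in> {1..h - 2}" "2 \<in> {1..h - 2}"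
      using h by auto
    have N1: "N (\<pi> 1) = {b, a}" and N2: "N (\<pi> 2) = {b, a}"
      using N_early early by blast+
    have "\<pi> 1 \<noteq> \<pi> 2" "a \<noteq> b"
      using inj h by (auto simp: a_def b_def dest: inj_onD)
    \<comment> \<open>The clique is \<open>{b, \<pi> 1}\<close>. Each remaining neighbour of
      \<open>a\<close> is an early vertex, with neighbourhood \<open>{b, a}\<close>, so the part
      belonging to \<open>\<pi> 1\<close> is empty.\<close>
    have "crystallized V E a"
    proof (rule crystallizedI[OF E, folded N_def])
      show "{a, b} \<in> E"
        using K(2)[OF early(1)] False early(1) N1 \<open>a \<noteq> b\<close> by (auto simp: clique_def)
      show "{a, \<pi> 1} \<in> E" "{b, \<pi> 1} \<in> E"
        using N1 N_sym[of _ "\<pi> 1"] by (simp_all add: N_iff)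
      have "\<pi> 2 \<in> N a" "\<pi> 2 \<noteq> b"
        using N2 N_sym[of _ "\<pi> 2"] edge(1)[of "\<pi> 2" b] by (simp_all flip: N_iff)
      then show "N a - {b, \<pi> 1} \<noteq> {}"
        using \<open>\<pi> 1 \<noteq> \<pi> 2\<close> by auto
    next
      fix x assume x: "x \<in> N a - {b, \<pi> 1}"
      then obtain k where k: "k \<in> {1..h}" "x = \<pi> k"
        using img edge[of a x] by (auto simp: N_iff)
      moreover have "x \<noteq> a" "x \<noteq> b"
        using x edge[of a x] by (auto simp: N_iff)
      ultimately have "k \<noteq> h - 1" "k \<noteq> h"
        by (auto simp: a_def b_def)
      with k have "k \<in> {1..h - 2}"
        by auto
      with N_early k show "N x = {b, a} \<or> N x = {\<pi> 1, a}"
        by blast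
    qed
    then show ?thesis ..
  qed
qed

end
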